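(* Consider a parallel network consisting of $2$ links, with lower and upper bounds on link weights $w^l,w^u\in\mathbb R^2_{>0}$, link capacities $c\in\mathbb R^2_{>0}$, and (post-disturbance) supply/demand of magnitude $\alpha\ge 0$. Then, for every $\lambda\in\mathbb R^2_{>0}$ and $w(0)\in[w^l,w^u]$, under the dynamics $\dot w_i(t)=u_i^2(w_i(t),f_i(t))$, $i\in\{1,2\}$, if $\alpha<\alpha^*$, then $\lim_{t\to+\infty}f(w(t))\in[0,c]$.
   Context: Parallel network: two links from a single supply node to a single demand node; for weights $w>\mathbf 0$ and supply/demand magnitude $\alpha$ the link flows are $f_i(w)=\alpha w_i/(w_1+w_2)$, and $f_i(t)=f_i(w(t))$ for $t\ge 0$. $f\in[0,c]$ means $0\le f_i\le c_i$ for $i=1,2$. Controller: $$u_i^2(w_i(t),f_i(t))=\begin{cases}-\lambda_i & \text{if } f_i(t)>c_i\text{ and }w_i(t)>w_i^l,\\ \lambda_i & \text{if } f_i(t)<c_i,\ \dot f_i(t^-)>0\text{ and }w_i(t)<w_i^u,\\ 0&\text{otherwise},\end{cases}$$ where $\dot f_i(t^-)=\lim_{\Delta t\to0^-}(f_i(t+\Delta t)-f_i(t))/\Delta t$ is the left derivative. Trajectories $w(t)$ are continuous. Disturbance: before time $0$ the weights are $w(0)$ and the supply/demand magnitude is some $\alpha_0\geq 0$ for which the flow is feasible, $\alpha_0w_i(0)/(w_1(0)+w_2(0))\le c_i$ for $i=1,2$; at $t=0$ the magnitude changes once and for all to $\alpha$. If $\alpha>\alpha_0$ (supply/demand increases)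 then the flows on both links increase at $t=0$ and by convention $\dot f_i(0^-)>0$ for both $i$; if supply/demand does not increase then $\dot f_i(0^-)>0$ holds for no $i$. $\alpha^*$ is the optimal value of: maximize $\alpha$ over $\alpha\in\mathbb R$, $w\in\mathbb R^2$ subject to $w^l\le w\le w^u$ and $0\le\alpha w_i/(w_1+w_2)\le c_i$, $i=1,2$. *)

theory Defs
  imports "HOL-Analysis.Analysis"
begin

text \<open>
  Vectors indexed by the two parallel links have type \<open>real ^ 2\<close>, with links \<open>1\<close> and \<open>2\<close>;
  the order on \<open>real ^ 2\<close>, hence each interval \<open>{a..b}\<close>, is componentwise.
\<close>

definition link_flow :: "real \<Rightarrow> real ^ 2 \<Rightarrow> real ^ 2" where
  "link_flow \<alpha> w = (\<chi> i. \<alpha> * w $ i / (w $ 1 + w $ 2))"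

text \<open>
  The feasible set is bounded above (by \<open>c $ 1 + c $ 2\<close>), and it is nonempty as soon as the
  weight box \<open>{wl..wu}\<close> is, so the supremum below is the optimal value of the program.
\<close>

definition alpha_star :: "real ^ 2 \<Rightarrow> real ^ 2 \<Rightarrow> real ^ 2 \<Rightarrow> real" where
  "alpha_star wl wu c = Sup {\<alpha>. \<exists>w \<in> {wl..wu}. link_flow \<alpha> w \<in> {0..c}}"

text \<open>
  \<open>flow_rising \<alpha>0 \<alpha> w i t\<close> renders the condition that the left derivative at \<open>t\<close> of the flow on
  link \<open>i\<close> is positive. For \<open>t > 0\<close> this means that the left derivative exists and is positive.
  At \<open>t = 0\<close> it is the convention for the disturbance: it holds, on both links, exactly when
  the supply/demand magnitude increases, from \<open>\<alpha>0\<close> to \<open>\<alpha>\<close>.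
\<close>

definition flow_rising ::
  "real \<Rightarrow> real \<Rightarrow> (real \<Rightarrow> real ^ 2) \<Rightarrow> 2 \<Rightarrow> real \<Rightarrow> bool" where
  "flow_rising \<alpha>0 \<alpha> w i t \<longleftrightarrow>
     (if t = 0 then \<alpha>0 < \<alpha>
      else \<exists>D > 0. ((\<lambda>s. link_flow \<alpha> (w s) $ i) has_real_derivative D) (at_left t))"

definition control ::
  "real \<Rightarrow> real \<Rightarrow> real ^ 2 \<Rightarrow> real ^ 2 \<Rightarrow> real ^ 2 \<Rightarrow> real ^ 2 \<Rightarrow> (real \<Rightarrow> real ^ 2) \<Rightarrow> real
     \<Rightarrow> real ^ 2" where
  "control \<alpha>0 \<alpha> wl wu c lam w t =
     (\<chi> i. if link_flow \<alpha> (w t) $ i > c $ i \<and> w t $ i > wl $ i then - lam $ i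
           else if link_flow \<alpha> (w t) $ i < c $ i \<and> flow_rising \<alpha>0 \<alpha> w i t \<and> w t $ i < wu $ i
             then lam $ i
           else 0)"

text \<open>
  The feedback is discontinuous and uses left derivatives, so the equation \<open>w' = u\<close> is read with
  right derivatives: the control determined at time \<open>t\<close> from the past of the flow is the rate at
  which the weights leave \<open>w t\<close>. An almost-everywhere reading would ignore the convention at
  \<open>t = 0\<close> and would let a rising weight stop at any time.

  There is one exception, at \<open>t = 0\<close> only. If the disturbance leaves both links strictly below
  capacity and both weights strictly below their upper bounds, then \<open>u(0) = lam\<close>. As the two flows
  add up to \<open>\<alpha>\<close>, they cannot both rise at any \<open>t > 0\<close>, so this control cannot be sustained for any
  positive time. In that case the equation is imposed for \<open>t > 0\<close> only, so that such initial
  conditions are not excluded for want of a trajectory.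
\<close>

definition trajectory ::
  "real \<Rightarrow> real \<Rightarrow> real ^ 2 \<Rightarrow> real ^ 2 \<Rightarrow> real ^ 2 \<Rightarrow> real ^ 2 \<Rightarrow> real ^ 2 \<Rightarrow> (real \<Rightarrow> real ^ 2)
     \<Rightarrow> bool" where
  "trajectory \<alpha>0 \<alpha> wl wu c lam w0 w \<longleftrightarrow>
     w 0 = w0 \<and> continuous_on {0..} w \<and>
     (\<forall>t \<ge> 0. \<not> (t = 0 \<and> control \<alpha>0 \<alpha> wl wu c lam w t = lam) \<longrightarrow>
        (w has_vector_derivative control \<alpha>0 \<alpha> wl wu c lam w t) (at_right t))"

end

theory Submission
  imports Defs
begin

text \<open>
  The two flows add up to \<open>\<alpha>\<close>, and \<open>\<alpha> < alpha_star\<close> provides weights in the box for which both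
  links are strictly below capacity; in particular \<open>\<alpha> < c $ i + c $ j\<close>, so at most one link can be
  overloaded. While link \<open>i\<close> is overloaded its weight does not rise and the other weight does not
  fall, so its flow does not rise. Hence a link at or below capacity stays there
  (\<open>capacity_kept\<close>), and once both links are, both weights only increase; being bounded,
  they converge, and so do the flows, to a feasible limit (\<open>flow_converges\<close>).

  What remains is that an overload of link \<open>i\<close> ends (\<open>overload_ends\<close>). If it lasted, the weight
  of \<open>i\<close> would fall at its constant rate to its lower bound. Meanwhile the flow on the other
  link \<open>j\<close> rises, which keeps the controller raising the weight of \<open>j\<close>, which in turn keeps the
  flow on \<open>j\<close> rising after the weight of \<open>i\<close> has stopped. So the weights reach the corner of the
  box that is most favourable to link \<open>i\<close> (\<open>overload_reaches_corner\<close>). There the flow on \<open>i\<close> is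
  at most the one of the strictly feasible weights, a contradiction.

  The delicate point is the sentence "keeps rising". The controller reacts to a left derivative,
  which need not exist, and the equation of motion prescribes right derivatives only; a priori
  the weight of \<open>j\<close> could switch between moving and resting on a set of times without any
  isolated switching time, in such a way that the left derivative of the flow is never defined
  where it matters. This is excluded by Baire's theorem (\<open>two_speed_rigidity\<close>): a right
  derivative is a pointwise limit of continuous functions, so the switching times, if there were
  any, would be locally of one kind near some switching time, and the rule of the controller at
  the ends of an interval of constant speed forbids this.
\<close>

section \<open>Monotonicity from one-sided derivatives\<close>

text \<open>
  At the last crossing of a slightly tilted line through a level just above \<open>c\<close> the right
  derivative would have to be positive. The offset of the line keeps this crossing away from the
  left end, so that only the derivatives at interior times enter: at the initial time of a
  trajectory the equation of motion may fail.
\<close>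

lemma right_derivative_barrier:
  fixes h :: "real \<Rightarrow> real"
  assumes "a \<le> b" and cont: "continuous_on {a..b} h" and "h a \<le> c"
    and down: "\<And>t. \<lbrakk>a < t; t < b; c < h t\<rbrakk> \<Longrightarrow>
      \<exists>d\<le>0. (h has_real_derivative d) (at_right t)"
  shows "h b \<le> c"
proof (rule ccontr)
  assume "\<not> h b \<le> c"
  then have above: "c < h b" and "a < b"
    using assms(1,3) by (auto simp: le_less)
  \<comment> \<open>A third of the excess for the offset and a third for the total tilt leave \<open>k b\<close> positive.\<close>
  define \<eta> where "\<eta> = (h b - c) / 3"
  define \<epsilon> where "\<epsilon> = \<eta> / (b - a)"
  have pos: "0 < \<eta>" "0 < \<epsilon>"
    using above \<open>a < b\<close> by (auto simp: \<eta>_def \<epsilon>_def)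
  have \<epsilon>_len: "\<epsilon> * (b - a) = \<eta>"
    using \<open>a < b\<close> by (simp add: \<epsilon>_def)
  define k where "k t = h t - c - \<eta> - \<epsilon> * (t - a)" for t
  have k_cont: "continuous_on {a..b} k"
    unfolding k_def by (intro continuous_intros cont)
  have k_ends: "k a < 0" "0 < k b"
    using assms(3) pos above unfolding k_def \<epsilon>_len by (auto simp: \<eta>_def)
  define Z where "Z = {t \<in> {a..b}. k t \<le> 0}"
  have "closed Z"
    unfolding Z_def by (rule continuous_on_closed_Collect_le[OF k_cont]) auto
  moreover have "a \<in> Z" "bdd_above Z"
    using k_ends \<open>a < b\<close> by (auto simp: Z_def intro: bdd_aboveI[of _ b])
  ultimately have "Sup Z \<in> Z"
    by (intro closed_contains_Sup) auto
  define s where "s = Sup Z"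
  have s: "a \<le> s" "s \<le> b" "k s \<le> 0"
    using \<open>Sup Z \<in> Z\<close> by (auto simp: s_def Z_def)
  have after: "0 < k t" if "s < t" "t \<le> b" for t
  proof (rule ccontr)
    assume "\<not> 0 < k t"
    then have "t \<in> Z" using that s by (auto simp: Z_def)
    then have "t \<le> s" unfolding s_def by (rule cSup_upper) fact
    then show False using that by simp
  qed
  have "s < b" using s k_ends by (cases "s = b") auto
  have "k s = 0"
  proof (rule ccontr)
    assume "k s \<noteq> 0"
    then have "k s < 0" using s by simp
    moreover have "continuous_on {s..b} k"
      using k_cont s by (auto intro: continuous_on_subset)
    ultimately obtain t where "s \<le> t" "t \<le> b" "k t = 0"
      using IVT'[of k s 0 b] k_ends \<open>s < b\<close> by auto
    then show False using after[of t] \<open>k s < 0\<close> by (cases "s = t") auto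
  qed
  then have "h s = c + \<eta> + \<epsilon> * (s - a)"
    by (simp add: k_def)
  moreover have "0 \<le> \<epsilon> * (s - a)" using pos s by simp
  ultimately have "c < h s" using pos by linarith
  moreover have "a < s" using s k_ends \<open>k s = 0\<close> by (cases "s = a") auto
  ultimately obtain d where d: "d \<le> 0" "(h has_real_derivative d) (at_right s)"
    using down \<open>s < b\<close> by blast
  have "(k has_real_derivative d - \<epsilon>) (at_right s)"
    unfolding k_def by (rule derivative_eq_intros d refl | simp)+
  then obtain \<delta> where \<delta>: "0 < \<delta>" "\<And>u. 0 < u \<Longrightarrow> u < \<delta> \<Longrightarrow> k (s + u) < k s"
    using has_real_derivative_neg_dec_right[of k "d - \<epsilon>" s "{s<..}"] d pos by auto
  define u where "u = min (\<delta> / 2) (b - s)"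
  have "0 < u" "u < \<delta>" "s + u \<le> b"
    using \<delta>(1) \<open>s < b\<close> by (auto simp: u_def)
  then show False
    using \<delta>(2)[of u] after[of "s + u"] \<open>k s = 0\<close> by auto
qed

lemma right_derivative_nonneg_mono:
  fixes h :: "real \<Rightarrow> real"
  assumes "a \<le> b" and "continuous_on {a..b} h"
    and up: "\<And>t. \<lbrakk>a < t; t < b\<rbrakk> \<Longrightarrow> \<exists>d\<ge>0. (h has_real_derivative d) (at_right t)"
  shows "h a \<le> h b"
proof -
  have "- h b \<le> - h a"
  proof (rule right_derivative_barrier[where h = "\<lambda>t. - h t"])
    fix t assume "a < t" "t < b"
    then obtain d where "d \<ge> 0" "(h has_real_derivative d) (at_right t)"
      using up by blast
    then show "\<exists>d\<le>0. ((\<lambda>t. - h t) has_real_derivative d) (at_right t)"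
      by (intro exI[of _ "- d"]) (auto intro: DERIV_minus)
  next
    show "continuous_on {a..b} (\<lambda>t. - h t)" by (rule continuous_on_minus) fact
  qed (use \<open>a \<le> b\<close> in simp_all)
  then show ?thesis by simp
qed

lemma right_derivative_const_linear:
  fixes h :: "real \<Rightarrow> real"
  assumes "a \<le> b" and cont: "continuous_on {a..b} h"
    and der: "\<And>t. \<lbrakk>a < t; t < b\<rbrakk> \<Longrightarrow> (h has_real_derivative v) (at_right t)"
  shows "h b = h a + v * (b - a)"
proof -
  have "h a - v * a \<le> h b - v * b"
    using assms(1)
  proof (rule right_derivative_nonneg_mono)
    fix t assume "a < t" "t < b"
    then show "\<exists>d\<ge>0. ((\<lambda>t. h t - v * t) has_real_derivative d) (at_right t)"
      by (intro exI[of _ 0] conjI) (rule derivative_eq_intros der refl | simp)+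
  qed (intro continuous_intros cont)
  moreover have "v * a - h a \<le> v * b - h b"
    using assms(1)
  proof (rule right_derivative_nonneg_mono)
    fix t assume "a < t" "t < b"
    then show "\<exists>d\<ge>0. ((\<lambda>t. v * t - h t) has_real_derivative d) (at_right t)"
      by (intro exI[of _ 0] conjI) (rule derivative_eq_intros der refl | simp)+
  qed (intro continuous_intros cont)
  ultimately show ?thesis by (simp add: algebra_simps)
qed

lemma mono_bounded_convergent_at_top:
  fixes h :: "real \<Rightarrow> real"
  assumes mono: "\<And>s t. \<lbrakk>a \<le> s; s \<le> t\<rbrakk> \<Longrightarrow> h s \<le> h t"
    and bound: "\<And>t. a \<le> t \<Longrightarrow> h t \<le> B"
  shows "\<exists>l. (h \<longlongrightarrow> l) at_top"
proof (rule exI, rule order_tendstoI)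
  fix y assume "y < Sup (h ` {a..})"
  then obtain s where "a \<le> s" "y < h s"
    by (auto elim!: less_cSupE)
  then show "\<forall>\<^sub>F t in at_top. y < h t"
    unfolding eventually_at_top_linorder using mono by (meson less_le_trans)
next
  have bdd: "bdd_above (h ` {a..})"
    using bound by (auto intro!: bdd_aboveI[of _ B])
  fix y assume "Sup (h ` {a..}) < y"
  then show "\<forall>\<^sub>F t in at_top. h t < y"
    unfolding eventually_at_top_linorder
    using cSUP_upper[OF _ bdd] by (metis atLeast_iff le_less_trans)
qed

section \<open>Switching between two speeds\<close>

text \<open>
  Let \<open>E\<close> be the closed set of times near which membership in \<open>A\<close> is not locally constant. If it is
  nonempty, Baire's theorem applied to \<open>E\<close> yields a point \<open>p\<close> of \<open>E\<close> and a ball around it in which \<open>E\<close>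
  lies in a single set of the cover, so that the points of \<open>E\<close> in this ball agree about membership.
  For a time \<open>t\<close> of the ball outside \<open>E\<close>, membership is constant from \<open>t\<close> up to the nearest point of
  \<open>E\<close> on the side of \<open>p\<close>, and by \<open>ends\<close> this point agrees with \<open>t\<close>. So membership
  is constant on the whole ball, which contradicts \<open>p \<in> E\<close>.
\<close>
lemma constant_by_interval_ends:
  fixes A :: "real set"
  assumes "countable \<F>"
    and closed: "\<And>F. F \<in> \<F> \<Longrightarrow> closed F"
    and cover: "{a..} \<subseteq> \<Union>\<F>"
    and pure: "\<And>F. F \<in> \<F> \<Longrightarrow> \<exists>v. \<forall>t\<in>F \<inter> {a..}. t \<in> A \<longleftrightarrow> v"
    and ends: "\<And>x y v. \<lbrakk>a \<le> x; x < y; \<forall>z\<in>{x<..<y}. z \<in> A \<longleftrightarrow> v\<rbrakk> \<Longrightarrow>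
      (x \<in> A \<longleftrightarrow> v) \<and> (y \<in> A \<longleftrightarrow> v)"
    and "a \<le> t"
  shows "t \<in> A \<longleftrightarrow> a \<in> A"
proof -
  define loc where "loc t \<longleftrightarrow> (\<forall>\<^sub>F s in at t within {a..}. t \<in> A \<longleftrightarrow> s \<in> A)" for t
  have const: "s \<in> A \<longleftrightarrow> t \<in> A"
    if "connected I" "\<forall>t\<in>I. a \<le> t \<and> loc t" "s \<in> I" "t \<in> I" for I s t
  proof (rule connected_local_const[OF that(1) that(3,4)])
    show "\<forall>s\<in>I. \<forall>\<^sub>F t in at s within I. (s \<in> A) = (t \<in> A)"
      using that(2) unfolding loc_def
      by (meson at_le filter_leD atLeast_iff subsetI)
  qed
  define E where "E = {t. a \<le> t \<and> \<not> loc t}"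
  have "closed E"
  proof -
    have "open (- E)"
    proof (rule openI)
      fix x assume "x \<in> - E"
      then consider "x < a" | "a \<le> x" "loc x" 
        by (cases "x < a") (auto simp: E_def not_less)
      then show "\<exists>e>0. ball x e \<subseteq> - E"
      proof cases
        case 1
        then show ?thesis
          by (intro exI[of _ "a - x"]) (auto simp: E_def dist_real_def)
      next
        case 2
        then obtain e where e: "e > 0"
          "\<And>s. \<lbrakk>a \<le> s; dist s x < e\<rbrakk> \<Longrightarrow> (x \<in> A) = (s \<in> A)"
          unfolding loc_def eventually_at by (metis atLeast_iff)
        have "loc y" if "a \<le> y" "y \<in> ball x e" for y
          unfolding loc_def eventually_at
        proof (intro exI[of _ "e - dist x y"] conjI ballI impI)
          fix s assume "s \<in> {a..}" "s \<noteq> y \<and> dist s y < e - dist x y"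
          then have "dist s x < e" using dist_triangle[of s x y] by (simp add: dist_commute)
          then show "(y \<in> A) = (s \<in> A)"
            using e(2)[of s] e(2)[of y] that \<open>s \<in> {a..}\<close> by (auto simp: dist_commute)
        qed (use that in auto)
        then show ?thesis using \<open>e > 0\<close> by (auto simp: E_def intro!: exI[of _ e])
      qed
    qed
    then show ?thesis by (simp add: open_closed)
  qed
  have "E = {}"
  proof (rule ccontr)
    assume "E \<noteq> {}"
    \<comment> \<open>The relative complements of the cover have empty intersection, so one of them is not dense.\<close>
    define \<G> where "\<G> = (\<lambda>F. E - F) ` \<F>"
    have "\<Inter>\<G> = {}"
    proof (rule equals0I)
      fix t assume t: "t \<in> \<Inter>\<G>"
      obtain F where "F \<in> \<F>" using cover by auto
      then have "t \<in> E - F" using t unfolding \<G>_def by blast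
      then have "a \<le> t" by (simp add: E_def)
      then obtain F' where "F' \<in> \<F>" "t \<in> F'" using cover by auto
      then show False using t unfolding \<G>_def by blast
    qed
    then have "\<not> E \<subseteq> closure (\<Inter>\<G>)" using \<open>E \<noteq> {}\<close> by simp
    then obtain T where "T \<in> \<G>" and T: "\<not> (openin (top_of_set E) T \<and> E \<subseteq> closure T)"
      using Baire[OF \<open>closed E\<close>, of \<G>] \<open>countable \<F>\<close> by (auto simp: \<G>_def)
    then obtain F where "F \<in> \<F>" "T = E - F" by (auto simp: \<G>_def)
    then have "openin (top_of_set E) T"
      using closed by (auto simp: openin_open intro: exI[of _ "- F"])
    then obtain p where "p \<in> E" "p \<notin> closure T" using T by auto
    then obtain e where "e > 0" and e: "ball p e \<inter> T = {}"
      by (metis closure_approachable disjoint_iff dist_commute mem_ball)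
    obtain v where "\<forall>t\<in>F \<inter> {a..}. t \<in> A \<longleftrightarrow> v" using pure \<open>F \<in> \<F>\<close> by blast
    then have onE: "t \<in> A \<longleftrightarrow> v" if "t \<in> E" "t \<in> ball p e" for t
      using that e \<open>T = E - F\<close> by (auto simp: E_def)
    have "a \<le> p" "\<not> loc p" using \<open>p \<in> E\<close> by (auto simp: E_def)
    have near: "t \<in> A \<longleftrightarrow> v" if "a \<le> t" "t \<in> ball p e" for t
    proof -
      consider "t \<in> E" | "t \<notin> E" "t < p" | "t \<notin> E" "p < t"
        using \<open>p \<in> E\<close> by (cases t p rule: linorder_cases) auto
      then show ?thesis
      proof cases
        case 1
        then show ?thesis using onE that by simp
      next
        case 2
        \<comment> \<open>the point of \<open>E\<close> nearest to \<open>t\<close> on the side of \<open>p\<close>\<close>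
        define y where "y = Inf (E \<inter> {t..p})"
        have bd: "bdd_below (E \<inter> {t..p})" by (auto intro: bdd_belowI[of _ t])
        have "y \<in> E \<inter> {t..p}"
          unfolding y_def using \<open>closed E\<close> \<open>p \<in> E\<close> 2 bd
          by (intro closed_contains_Inf) auto
        then have y: "y \<in> E" "t < y" "y \<le> p"
          using 2 by (auto simp: le_less)
        have free: "a \<le> s \<and> loc s" if "t \<le> s" "s < y" for s
        proof (rule ccontr)
          assume "\<not> (a \<le> s \<and> loc s)"
          then have "s \<in> E \<inter> {t..p}" using that y \<open>a \<le> t\<close> by (auto simp: E_def)
          then have "y \<le> s" unfolding y_def using bd by (rule cInf_lower)
          then show False using that by simp
        qed
        have same: "\<forall>z\<in>{t<..<y}. z \<in> A \<longleftrightarrow> t \<in> A"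
          by (intro ballI const[of "{t..<y}"]) (use free y in auto)
        then have "y \<in> A \<longleftrightarrow> t \<in> A" using ends[OF \<open>a \<le> t\<close> y(2) same] by simp
        moreover have "y \<in> ball p e" using y that by (auto simp: dist_real_def)
        ultimately show ?thesis using onE y by blast
      next
        case 3
        define y where "y = Sup (E \<inter> {p..t})"
        have bd: "bdd_above (E \<inter> {p..t})" by (auto intro: bdd_aboveI[of _ t])
        have "y \<in> E \<inter> {p..t}"
          unfolding y_def using \<open>closed E\<close> \<open>p \<in> E\<close> 3 bd
          by (intro closed_contains_Sup) auto
        then have y: "y \<in> E" "y < t" "p \<le> y"
          using 3 by (auto simp: le_less)
        have free: "a \<le> s \<and> loc s" if "y < s" "s \<le> t" for s
        proof (rule ccontr)
          assume "\<not> (a \<le> s \<and> loc s)"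
          then have "s \<in> E \<inter> {p..t}" using that y \<open>a \<le> p\<close> by (auto simp: E_def)
          then have "s \<le> y" unfolding y_def using bd by (rule cSup_upper)
          then show False using that by simp
        qed
        have same: "\<forall>z\<in>{y<..<t}. z \<in> A \<longleftrightarrow> t \<in> A"
          by (intro ballI const[of "{y<..t}"]) (use free y in auto)
        then have "y \<in> A \<longleftrightarrow> t \<in> A" using ends[OF _ y(2) same] \<open>a \<le> p\<close> y(3) by simp
        moreover have "y \<in> ball p e" using y that by (auto simp: dist_real_def)
        ultimately show ?thesis using onE y by blast
      qed
    qed
    have "loc p"
      unfolding loc_def eventually_at
      using near \<open>e > 0\<close> \<open>a \<le> p\<close>
      by (intro exI[of _ e]) (auto simp: dist_commute)
    then show False using \<open>\<not> loc p\<close> by simp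
  qed
  then have "\<forall>t\<in>{a..}. loc t" by (auto simp: E_def)
  then show ?thesis using const[of "{a..}" t a] \<open>a \<le> t\<close> by auto
qed


lemma one_sided_derivative_unique:
  fixes f :: "real \<Rightarrow> real"
  assumes "(f has_real_derivative d) (at x within S)" "(f has_real_derivative e) (at x within S)"
    and "at x within S \<noteq> bot"
  shows "d = e"
  using assms tendsto_unique unfolding has_field_derivative_iff by blast

lemma linear_imp_one_sided_derivative:
  fixes h :: "real \<Rightarrow> real"
  assumes "x < y" and lin: "\<And>s. \<lbrakk>x \<le> s; s \<le> y\<rbrakk> \<Longrightarrow> h s = h x + v * (s - x)"
  shows "(h has_real_derivative v) (at_right x)" "(h has_real_derivative v) (at_left y)"
proof -
  have lin_der: "((\<lambda>s. h x + v * (s - x)) has_real_derivative v) (at z within S)" for z S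
    by (rule derivative_eq_intros refl | simp)+
  have "\<forall>\<^sub>F s in at_right x. h s = h x + v * (s - x)"
    unfolding eventually_at_right_field
    by (rule exI[of _ y]) (intro conjI allI impI lin; use \<open>x < y\<close> in simp)
  then show "(h has_real_derivative v) (at_right x)"
    by (rule has_field_derivative_cong_eventually[THEN iffD2, OF _ _ lin_der])
      (rule lin; use \<open>x < y\<close> in simp)
  have "\<forall>\<^sub>F s in at_left y. h s = h x + v * (s - x)"
    unfolding eventually_at_left_field
    by (rule exI[of _ x]) (intro conjI allI impI lin; use \<open>x < y\<close> in simp)
  then show "(h has_real_derivative v) (at_left y)"
    by (rule has_field_derivative_cong_eventually[THEN iffD2, OF _ _ lin_der])
      (rule lin; use \<open>x < y\<close> in simp)
qed

text \<open>
  A function whose right derivative is always \<open>0\<close> or \<open>\<nu>\<close> has one speed only, if after each open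
  interval of constant speed that speed is still the one at the right end. At the left end this
  holds by itself, since the function is linear on the closed interval. The closed sets for
  \<open>constant_by_interval_ends\<close> collect the times at which the difference quotients with step
  \<open>1 / Suc n\<close> lie on one side of \<open>\<nu> / 2\<close> from some index on; the limit then decides the speed.
\<close>
lemma two_speed_rigidity:
  fixes g :: "real \<Rightarrow> real"
  assumes "0 < \<nu>" and cont: "continuous_on {a..} g"
    and der: "\<And>t. a \<le> t \<Longrightarrow> (g has_real_derivative (if t \<in> A then \<nu> else 0)) (at_right t)"
    and right_end: "\<And>x y v. \<lbrakk>a \<le> x; x < y; \<forall>z\<in>{x<..<y}. z \<in> A \<longleftrightarrow> v\<rbrakk> \<Longrightarrow> y \<in> A \<longleftrightarrow> v"
    and "a \<le> t"
  shows "t \<in> A \<longleftrightarrow> a \<in> A"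
proof -
  define rate where "rate n t = (g (t + 1 / Suc n) - g t) * Suc n" for n :: nat and t
  define slow where "slow N = {t \<in> {a..}. \<forall>n\<ge>N. rate n t \<le> \<nu> / 2}" for N :: nat
  define fast where "fast N = {t \<in> {a..}. \<forall>n\<ge>N. \<nu> / 2 \<le> rate n t}" for N :: nat
  have rate_lim: "(\<lambda>n. rate n t) \<longlonglongrightarrow> (if t \<in> A then \<nu> else 0)" if "a \<le> t" for t
  proof -
    have lim: "((\<lambda>y. (g y - g t) / (y - t)) \<longlongrightarrow> (if t \<in> A then \<nu> else 0)) (at_right t)"
      using der[OF that] by (simp add: has_field_derivative_iff)
    have seq: "filterlim (\<lambda>n. t + 1 / Suc n) (at_right t) sequentially"
      unfolding filterlim_at
      using tendsto_add[OF tendsto_const[of t] LIMSEQ_inverse_real_of_nat]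
      by (auto simp: inverse_eq_divide)
    have "rate = (\<lambda>n t. (g (t + 1 / Suc n) - g t) / (t + 1 / Suc n - t))"
      by (simp only: rate_def fun_eq_iff add_diff_cancel_left' divide_divide_eq_right div_by_1) simp
    then show ?thesis using filterlim_compose[OF lim seq] by simp
  qed
  have rate_cont: "continuous_on {a..} (rate n)" for n
  proof -
    have "continuous_on {a..} (\<lambda>t. g (t + 1 / Suc n))"
      by (rule continuous_on_compose2[OF cont]) (auto intro!: continuous_intros add_increasing2)
    then show ?thesis unfolding rate_def by (intro continuous_intros cont)
  qed
  have slow_stopped: "t \<notin> A" if "t \<in> slow N" for t N
  proof -
    have "(if t \<in> A then \<nu> else 0) \<le> \<nu> / 2"
      using rate_lim[of t] that
      by (intro LIMSEQ_le_const2[of "\<lambda>n. rate n t"]) (auto simp: slow_def)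
    then show ?thesis using \<open>0 < \<nu>\<close> by auto
  qed
  have fast_moving: "t \<in> A" if "t \<in> fast N" for t N
  proof -
    have "\<nu> / 2 \<le> (if t \<in> A then \<nu> else 0)"
      using rate_lim[of t] that
      by (intro LIMSEQ_le_const[of "\<lambda>n. rate n t"]) (auto simp: fast_def)
    then show ?thesis using \<open>0 < \<nu>\<close> by (auto split: if_splits)
  qed
  have closed_slow: "closed (slow N)" for N
  proof -
    have "closed {t \<in> {a..}. rate n t \<le> \<nu> / 2}" for n
      by (rule continuous_on_closed_Collect_le[OF rate_cont]) auto
    then have "closed (\<Inter>n\<in>{N..}. {t \<in> {a..}. rate n t \<le> \<nu> / 2})" by blast
    also have "\<dots> = slow N" by (auto simp: slow_def)
    finally show ?thesis .
  qed
  have closed_fast: "closed (fast N)" for N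
  proof -
    have "closed {t \<in> {a..}. \<nu> / 2 \<le> rate n t}" for n
      by (rule continuous_on_closed_Collect_le[OF _ rate_cont]) auto
    then have "closed (\<Inter>n\<in>{N..}. {t \<in> {a..}. \<nu> / 2 \<le> rate n t})" by blast
    also have "\<dots> = fast N" by (auto simp: fast_def)
    finally show ?thesis .
  qed
  show ?thesis
  proof (rule constant_by_interval_ends[where \<F> = "range slow \<union> range fast"])
    show "closed F" if "F \<in> range slow \<union> range fast" for F
      using that closed_slow closed_fast by auto
  next
    show "{a..} \<subseteq> \<Union>(range slow \<union> range fast)"
    proof
      fix t assume "t \<in> {a..}"
      then have t: "a \<le> t" by simp
      show "t \<in> \<Union>(range slow \<union> range fast)"
      proof (cases "t \<in> A")
        case True
        then have "\<forall>\<^sub>F n in sequentially. \<nu> / 2 < rate n t"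
          using rate_lim[OF t] \<open>0 < \<nu>\<close> by (intro order_tendstoD) auto
        then obtain N where "\<forall>n\<ge>N. \<nu> / 2 < rate n t"
          by (auto simp: eventually_sequentially)
        then have "t \<in> fast N" using t by (auto simp: fast_def less_imp_le)
        then show ?thesis by auto
      next
        case False
        then have "\<forall>\<^sub>F n in sequentially. rate n t < \<nu> / 2"
          using rate_lim[OF t] \<open>0 < \<nu>\<close> by (intro order_tendstoD) auto
        then obtain N where "\<forall>n\<ge>N. rate n t < \<nu> / 2"
          by (auto simp: eventually_sequentially)
        then have "t \<in> slow N" using t by (auto simp: slow_def less_imp_le)
        then show ?thesis by auto
      qed
    qed
  next
    show "\<exists>v. \<forall>t\<in>F \<inter> {a..}. t \<in> A \<longleftrightarrow> v" if "F \<in> range slow \<union> range fast" for F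
      using that slow_stopped fast_moving by blast
  next
    fix x y v assume x: "a \<le> x" "x < y" and v: "\<forall>z\<in>{x<..<y}. z \<in> A \<longleftrightarrow> v"
    have lin: "g s = g x + (if v then \<nu> else 0) * (s - x)" if "x \<le> s" "s \<le> y" for s
    proof (rule right_derivative_const_linear)
      show "continuous_on {x..s} g" using cont x by (auto intro: continuous_on_subset)
      fix z assume "x < z" "z < s"
      then show "(g has_real_derivative (if v then \<nu> else 0)) (at_right z)"
        using der[of z] v x that by auto
    qed fact
    have "(if v then \<nu> else 0) = (if x \<in> A then \<nu> else 0)"
      by (rule one_sided_derivative_unique[OF linear_imp_one_sided_derivative(1)[OF \<open>x < y\<close> lin]
            der[OF \<open>a \<le> x\<close>]]) auto
    then show "(x \<in> A \<longleftrightarrow> v) \<and> (y \<in> A \<longleftrightarrow> v)"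
      using right_end[OF x v] \<open>0 < \<nu>\<close> by (auto split: if_splits)
  qed (use \<open>a \<le> t\<close> in auto)
qed

section \<open>The end of an overload\<close>

text \<open>
  Here \<open>p\<close> is the weight of an overloaded link and \<open>q\<close> the weight of the other link; the flow on
  the latter counts as rising at the times in \<open>R\<close>. If \<open>q\<close> stayed below \<open>qu\<close>, then it would move exactly
  at the times in \<open>R\<close>, and its speed would satisfy the rule of \<open>two_speed_rigidity\<close>: after an
  interval of motion the flow is rising, hence \<open>q\<close> moves on; an interval of rest is possible only
  when \<open>p\<close> has stopped as well, and then the flow is constant and \<open>q\<close> rests on. Since \<open>q\<close> moves at
  time \<open>0\<close>, it would move forever and exceed \<open>qu\<close>. The bounds are attained for good, so there is a
  common time.
\<close>
lemma overload_reaches_corner: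
  fixes p q :: "real \<Rightarrow> real"
  assumes pos: "0 < \<alpha>" "0 < \<mu>" "0 < \<nu>" "0 < pl"
    and cont: "continuous_on {0..} p" "continuous_on {0..} q"
    and p_ge: "\<And>t. 0 \<le> t \<Longrightarrow> pl \<le> p t"
    and q_pos: "\<And>t. 0 \<le> t \<Longrightarrow> 0 < q t" and q_le: "\<And>t. 0 \<le> t \<Longrightarrow> q t \<le> qu"
    and p_der: "\<And>t. 0 \<le> t \<Longrightarrow> (p has_real_derivative (if pl < p t then - \<mu> else 0)) (at_right t)"
    and q_der: "\<And>t. 0 \<le> t \<Longrightarrow>
      (q has_real_derivative (if R t \<and> q t < qu then \<nu> else 0)) (at_right t)"
    and R0: "R 0"
    and R: "\<And>t. 0 < t \<Longrightarrow>
      R t \<longleftrightarrow> (\<exists>D>0. ((\<lambda>s. \<alpha> * q s / (p s + q s)) has_real_derivative D) (at_left t))"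
  shows "\<exists>t\<ge>0. p t = pl \<and> q t = qu"
proof -
  have cont_on: "continuous_on {s..t} p" "continuous_on {s..t} q" if "0 \<le> s" for s t
    using cont that by (auto intro: continuous_on_subset)
  have p_anti: "p t \<le> p s" if "0 \<le> s" "s \<le> t" for s t
    using \<open>s \<le> t\<close> cont_on(1)[OF \<open>0 \<le> s\<close>, of t] order_refl
  proof (rule right_derivative_barrier)
    fix z assume "s < z"
    then show "\<exists>d\<le>0. (p has_real_derivative d) (at_right z)"
      using p_der[of z] \<open>0 \<le> s\<close> \<open>0 < \<mu>\<close>
      by (intro exI[of _ "if pl < p z then - \<mu> else 0"]) auto
  qed
  have q_mono: "q s \<le> q t" if "0 \<le> s" "s \<le> t" for s t
    using \<open>s \<le> t\<close> cont_on(2)[OF \<open>0 \<le> s\<close>, of t]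
  proof (rule right_derivative_nonneg_mono)
    fix z assume "s < z"
    then show "\<exists>d\<ge>0. (q has_real_derivative d) (at_right z)"
      using q_der[of z] \<open>0 \<le> s\<close> \<open>0 < \<nu>\<close>
      by (intro exI[of _ "if R z \<and> q z < qu then \<nu> else 0"]) auto
  qed
  have p_stays: "p t = pl" if "0 \<le> s" "s \<le> t" "p s = pl" for s t
    using p_anti[OF that(1,2)] p_ge[of t] that by simp
  have p_falls: "p t = p 0 - \<mu> * t" if "0 \<le> t" "\<forall>s. 0 \<le> s \<and> s < t \<longrightarrow> p s \<noteq> pl" for t
  proof -
    have "p t = p 0 + (- \<mu>) * (t - 0)"
      using \<open>0 \<le> t\<close> cont_on(1)[OF order_refl, of t]
    proof (rule right_derivative_const_linear)
      fix z assume "0 < z" "z < t"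
      then show "(p has_real_derivative - \<mu>) (at_right z)"
        using p_der[of z] p_ge[of z] that by (auto simp: less_le)
    qed
    then show ?thesis by simp
  qed
  obtain \<tau> where \<tau>: "0 \<le> \<tau>" "p \<tau> = pl"
  proof (rule ccontr)
    assume "\<not> thesis"
    then have "\<forall>s\<ge>0. p s \<noteq> pl" using that by blast
    moreover have "0 \<le> p 0 / \<mu>" using pos p_ge[of 0] by simp
    ultimately have "p (p 0 / \<mu>) = 0" using p_falls[of "p 0 / \<mu>"] pos by simp
    then show False using p_ge[OF \<open>0 \<le> p 0 / \<mu>\<close>] pos by simp
  qed
  have "\<exists>\<sigma>\<ge>0. q \<sigma> = qu"
  proof (rule ccontr)
    assume "\<not> (\<exists>\<sigma>\<ge>0. q \<sigma> = qu)"
    then have q_less: "q t < qu" if "0 \<le> t" for t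
      using q_le[OF that] that by (auto simp: less_le)
    \<comment> \<open>The inequality is strict so that \<open>hit t\<close> describes the motion of \<open>p\<close> just before \<open>t\<close>.\<close>
    define hit where "hit t \<longleftrightarrow> (\<exists>s. 0 \<le> s \<and> s < t \<and> p s = pl)" for t
    have p_left: "(p has_real_derivative (if hit t then 0 else - \<mu>)) (at_left t)"
      if "0 < t" for t
    proof (cases "hit t")
      case True
      then obtain s where s: "0 \<le> s" "s < t" "p s = pl" by (auto simp: hit_def)
      have "(p has_real_derivative 0) (at_left t)"
        using \<open>s < t\<close> by (rule linear_imp_one_sided_derivative(2)) (use s p_stays[OF s(1) _ s(3)] in simp)
      then show ?thesis using True by simp
    next
      case False
      have "(p has_real_derivative - \<mu>) (at_left t)"
        using \<open>0 < t\<close>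
      proof (rule linear_imp_one_sided_derivative(2))
        fix s assume "0 \<le> s" "s \<le> t"
        then have "\<forall>r. 0 \<le> r \<and> r < s \<longrightarrow> p r \<noteq> pl" using False by (force simp: hit_def)
        then show "p s = p 0 + - \<mu> * (s - 0)" using p_falls[OF \<open>0 \<le> s\<close>] by simp
      qed
      then show ?thesis by (simp only: False if_False)
    qed
    have R_iff: "R t \<longleftrightarrow> d < 0 \<or> 0 < e"
      if t: "0 < t" and d: "(p has_real_derivative d) (at_left t)" "d \<le> 0"
        and e: "(q has_real_derivative e) (at_left t)" "0 \<le> e" for t d e
    proof -
      have pq: "0 < p t" "0 < q t" using p_ge[of t] q_pos[of t] pos t by auto
      define D where "D = \<alpha> * (e * p t - q t * d) / (p t + q t)^2"
      have D_eq: "D = ((\<alpha> * e) * (p t + q t) - (\<alpha> * q t) * (d + e)) / ((p t + q t) * (p t + q t))"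
        by (simp add: D_def power2_eq_square algebra_simps)
      have "p t + q t \<noteq> 0" using pq by simp
      then have flow: "((\<lambda>s. \<alpha> * q s / (p s + q s)) has_real_derivative D) (at_left t)"
        unfolding D_eq by (intro DERIV_divide DERIV_cmult DERIV_add d(1) e(1))
      have "R t \<longleftrightarrow> 0 < D"
        unfolding R[OF t] using flow one_sided_derivative_unique[OF _ flow]
        by (metis trivial_limit_at_left_real)
      also have "\<dots> \<longleftrightarrow> 0 < e * p t - q t * d"
        using pq pos by (auto simp: D_def zero_less_divide_iff zero_less_mult_iff)
      also have "\<dots> \<longleftrightarrow> d < 0 \<or> 0 < e"
      proof -
        have "0 \<le> e * p t" "q t * d \<le> 0" using pq d e by (auto simp: mult_nonneg_nonpos)
        moreover have "0 < e * p t \<longleftrightarrow> 0 < e" "q t * d < 0 \<longleftrightarrow> d < 0"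
          using pq by (auto simp: zero_less_mult_iff mult_less_0_iff)
        ultimately show ?thesis by linarith
      qed
      finally show ?thesis .
    qed
    have R_iff_hit: "R t \<longleftrightarrow> \<not> hit t \<or> 0 < e"
      if "0 < t" "(q has_real_derivative e) (at_left t)" "0 \<le> e" for t e
      using R_iff[OF that(1) p_left[OF that(1)] _ that(2,3)] pos by (cases "hit t") auto
    have R_always: "R t" if "0 \<le> t" for t
    proof -
      have "t \<in> Collect R \<longleftrightarrow> 0 \<in> Collect R"
      proof (rule two_speed_rigidity[OF \<open>0 < \<nu>\<close> cont(2)])
        show "(q has_real_derivative (if s \<in> Collect R then \<nu> else 0)) (at_right s)" if "0 \<le> s" for s
          using q_der[OF that] q_less[OF that] by simp
      next
        fix x y v assume x: "0 \<le> x" "x < y" and v: "\<forall>z\<in>{x<..<y}. z \<in> Collect R \<longleftrightarrow> v"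
        have q_lin: "q s = q x + (if v then \<nu> else 0) * (s - x)" if "x \<le> s" "s \<le> y" for s
        proof (rule right_derivative_const_linear[OF \<open>x \<le> s\<close> cont_on(2)[OF \<open>0 \<le> x\<close>]])
          fix z assume "x < z" "z < s"
          then show "(q has_real_derivative (if v then \<nu> else 0)) (at_right z)"
            using q_der[of z] q_less[of z] v x that by auto
        qed
        have q_left: "(q has_real_derivative (if v then \<nu> else 0)) (at_left z)"
          if "x < z" "z \<le> y" for z
          by (rule linear_imp_one_sided_derivative(2)[OF \<open>x < z\<close>], rule q_lin)
            (use that in linarith)+
        have R_eq: "R z \<longleftrightarrow> \<not> hit z \<or> v" if "x < z" "z \<le> y" for z
          using R_iff_hit[OF _ q_left[OF that]] that x pos by (cases v) auto
        show "y \<in> Collect R \<longleftrightarrow> v"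
        proof (cases v)
          case True
          then show ?thesis using R_eq[of y] x by simp
        next
          case False
          \<comment> \<open>Any interior time will do: resting there shows that \<open>p\<close> has already stopped.\<close>
          define z where "z = (x + y) / 2"
          have z: "x < z" "z < y" using \<open>x < y\<close> by (auto simp: z_def)
          then have "\<not> R z" using v False by simp
          then have "hit z" using R_eq[of z] z by simp
          then have "hit y" using z by (force simp: hit_def)
          then show ?thesis using R_eq[of y] x False by simp
        qed
      qed fact
      then show ?thesis using R0 by simp
    qed
    have "0 \<le> qu / \<nu>" using q_pos[of 0] q_le[of 0] pos by simp
    have "q (qu / \<nu>) = q 0 + \<nu> * (qu / \<nu> - 0)"
    proof (rule right_derivative_const_linear[OF \<open>0 \<le> qu / \<nu>\<close> cont_on(2)[OF order_refl]])
      show "(q has_real_derivative \<nu>) (at_right z)" if "0 < z" for z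
        using q_der[of z] R_always[of z] q_less[of z] that by simp
    qed
    then show False using q_less[OF \<open>0 \<le> qu / \<nu>\<close>] q_pos[of 0] pos by simp
  qed
  then obtain \<sigma> where \<sigma>: "0 \<le> \<sigma>" "q \<sigma> = qu" by blast
  have "p (max \<sigma> \<tau>) = pl" using p_stays[of \<tau>] \<tau> by simp
  moreover have "q (max \<sigma> \<tau>) = qu"
    using q_mono[of \<sigma> "max \<sigma> \<tau>"] q_le[of "max \<sigma> \<tau>"] \<sigma> by simp
  ultimately show ?thesis using \<tau> by (intro exI[of _ "max \<sigma> \<tau>"]) auto
qed

section \<open>Flows on two parallel links\<close>

lemma sum_two_links:
  fixes v :: "real ^ 2" and i j :: 2
  assumes "i \<noteq> j"
  shows "v $ 1 + v $ 2 = v $ i + v $ j"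
  using exhaust_2[of i] exhaust_2[of j] assms by auto

lemma link_flow_nth:
  assumes "i \<noteq> j"
  shows "link_flow \<alpha> v $ i = \<alpha> * v $ i / (v $ i + v $ j)"
  using sum_two_links[OF assms] by (simp add: link_flow_def)

lemma link_flow_add:
  assumes "i \<noteq> j" and "0 < v $ i + v $ j"
  shows "link_flow \<alpha> v $ i + link_flow \<alpha> v $ j = \<alpha>"
  using assms(2) sum_two_links[OF assms(1)]
  by (simp add: link_flow_def add_divide_distrib[symmetric] distrib_left[symmetric])

lemma link_flow_mono:
  assumes "i \<noteq> j" "0 \<le> \<alpha>" "0 < u $ i" "0 < v $ j" "u $ i \<le> v $ i" "v $ j \<le> u $ j"
  shows "link_flow \<alpha> u $ i \<le> link_flow \<alpha> v $ i"
proof -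
  have "u $ i * v $ j \<le> v $ i * u $ j"
    using assms by (intro mult_mono) auto
  then have "u $ i / (u $ i + u $ j) \<le> v $ i / (v $ i + v $ j)"
    using assms by (simp add: divide_simps algebra_simps)
  then have "\<alpha> * (u $ i / (u $ i + u $ j)) \<le> \<alpha> * (v $ i / (v $ i + v $ j))"
    using \<open>0 \<le> \<alpha>\<close> by (rule mult_left_mono)
  then show ?thesis by (simp add: link_flow_nth[OF \<open>i \<noteq> j\<close>])
qed

lemma link_flow_has_derivative:
  assumes "i \<noteq> j" and "0 < w t $ i" "0 < w t $ j"
    and "((\<lambda>s. w s $ i) has_real_derivative d) (at t within S)"
    and "((\<lambda>s. w s $ j) has_real_derivative e) (at t within S)"
  shows "((\<lambda>s. link_flow \<alpha> (w s) $ i) has_real_derivative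
    \<alpha> * (d * w t $ j - w t $ i * e) / (w t $ i + w t $ j)^2) (at t within S)"
  unfolding link_flow_nth[OF assms(1)]
proof (rule DERIV_cong)
  show "((\<lambda>s. \<alpha> * w s $ i / (w s $ i + w s $ j)) has_real_derivative
      ((\<alpha> * d) * (w t $ i + w t $ j) - (\<alpha> * w t $ i) * (d + e))
        / ((w t $ i + w t $ j) * (w t $ i + w t $ j))) (at t within S)"
    using assms by (intro DERIV_divide DERIV_cmult DERIV_add) auto
qed (simp add: power2_eq_square algebra_simps)

text \<open>
  Weights that carry some magnitude above \<open>\<alpha>\<close> leave slack on both links when they carry \<open>\<alpha>\<close>,
  because the share of each link is positive.
\<close>
lemma below_alpha_star_feasible:
  assumes "\<forall>i. 0 < wl $ i" "\<forall>i. 0 < c $ i" "wl \<le> wu" "0 \<le> \<alpha>" "\<alpha> < alpha_star wl wu c"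
  obtains v where "v \<in> {wl..wu}" "\<forall>i. link_flow \<alpha> v $ i < c $ i"
proof -
  let ?X = "{\<alpha>. \<exists>v \<in> {wl..wu}. link_flow \<alpha> v \<in> {0..c}}"
  have "0 \<in> ?X"
    using assms by (auto simp: link_flow_def less_eq_vec_def intro!: bexI[of _ wl] less_imp_le)
  then obtain \<beta> where "\<beta> \<in> ?X" "\<alpha> < \<beta>"
    using assms(5) unfolding alpha_star_def by (elim less_cSupE) auto
  then obtain v where v: "v \<in> {wl..wu}" "link_flow \<beta> v \<in> {0..c}" by blast
  have "link_flow \<alpha> v $ i < c $ i" for i
  proof -
    have "0 < v $ k" for k
      using v assms(1) by (auto simp: less_eq_vec_def intro: less_le_trans)
    then have "0 < v $ i / (v $ 1 + v $ 2)" by (intro divide_pos_pos add_pos_pos)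
    then have "\<alpha> * (v $ i / (v $ 1 + v $ 2)) < \<beta> * (v $ i / (v $ 1 + v $ 2))"
      using \<open>\<alpha> < \<beta>\<close> by (intro mult_strict_right_mono)
    also have "\<dots> = link_flow \<beta> v $ i" by (simp add: link_flow_def)
    also have "\<dots> \<le> c $ i" using v(2) by (simp add: less_eq_vec_def)
    finally show ?thesis by (simp add: link_flow_def)
  qed
  with v that show ?thesis by blast
qed

section \<open>Trajectories of the controlled network\<close>

locale controlled_network =
  fixes \<alpha>0 \<alpha> :: real and wl wu c lam w0 :: "real ^ 2" and w :: "real \<Rightarrow> real ^ 2"
  assumes wl_pos: "\<forall>i. 0 < wl $ i" and c_pos: "\<forall>i. 0 < c $ i" and lam_pos: "\<forall>i. 0 < lam $ i"
    and alpha_nonneg: "0 \<le> \<alpha>"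
    and start: "w0 \<in> {wl..wu}" "\<forall>i. link_flow \<alpha>0 w0 $ i \<le> c $ i"
    and traj: "trajectory \<alpha>0 \<alpha> wl wu c lam w0 w"
    and below_star: "\<alpha> < alpha_star wl wu c"
begin

abbreviation f :: "real \<Rightarrow> real ^ 2" where "f t \<equiv> link_flow \<alpha> (w t)"

abbreviation u :: "real \<Rightarrow> real ^ 2" where "u \<equiv> control \<alpha>0 \<alpha> wl wu c lam w"

lemma weight_cont: "continuous_on {0..} (\<lambda>t. w t $ k)"
  using traj unfolding trajectory_def by (intro continuous_on_component) simp

text \<open>
  One weight that does not start at its full positive rate is enough to rule out the exceptional
  case at time \<open>0\<close>, in which the equation of motion is not imposed.
\<close>
lemma weight_derivative:
  assumes "0 \<le> t" and "t = 0 \<Longrightarrow> u t $ i < lam $ i"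
  shows "((\<lambda>s. w s $ k) has_real_derivative u t $ k) (at_right t)"
proof -
  have "(w has_vector_derivative u t) (at_right t)"
    using traj assms by (force simp: trajectory_def)
  then show ?thesis
    unfolding has_real_derivative_iff_has_vector_derivative
    by (rule bounded_linear.has_vector_derivative[OF bounded_linear_vec_nth])
qed

lemma weight_in_box:
  assumes "0 \<le> t"
  shows "wl $ k \<le> w t $ k" "w t $ k \<le> wu $ k"
proof -
  have cont: "continuous_on {0..t} (\<lambda>t. w t $ k)"
    using weight_cont by (rule continuous_on_subset) auto
  have init: "wl $ k \<le> w 0 $ k" "w 0 $ k \<le> wu $ k"
    using start traj by (auto simp: trajectory_def less_eq_vec_def)
  show "w t $ k \<le> wu $ k"
    using assms cont init(2)
  proof (rule right_derivative_barrier)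
    fix z assume "0 < z" "wu $ k < w z $ k"
    then have "u z $ k \<le> 0" using lam_pos by (auto simp: control_def less_imp_le)
    then show "\<exists>d\<le>0. ((\<lambda>t. w t $ k) has_real_derivative d) (at_right z)"
      using weight_derivative[of z] \<open>0 < z\<close> by (intro exI[of _ "u z $ k"]) auto
  qed
  have "- w t $ k \<le> - wl $ k"
    using assms
  proof (rule right_derivative_barrier[where h = "\<lambda>t. - w t $ k"])
    show "continuous_on {0..t} (\<lambda>t. - w t $ k)"
      using cont by (rule continuous_on_minus)
    fix z assume "0 < z" "- wl $ k < - w z $ k"
    then have "0 \<le> u z $ k" using lam_pos by (auto simp: control_def less_imp_le)
    moreover have "((\<lambda>t. - w t $ k) has_real_derivative - u z $ k) (at_right z)"
      using weight_derivative[of z] \<open>0 < z\<close> by (intro DERIV_minus) auto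
    ultimately show "\<exists>d\<le>0. ((\<lambda>t. - w t $ k) has_real_derivative d) (at_right z)"
      by (intro exI[of _ "- u z $ k"]) auto
  qed (use init in auto)
  then show "wl $ k \<le> w t $ k" by simp
qed

lemma weight_pos: "0 \<le> t \<Longrightarrow> 0 < w t $ k"
  using weight_in_box(1)[of t k] wl_pos[rule_format, of k] by simp

lemma feasible_weights:
  obtains v where "v \<in> {wl..wu}" "\<forall>i. link_flow \<alpha> v $ i < c $ i"
proof (rule below_alpha_star_feasible[OF wl_pos c_pos _ alpha_nonneg below_star])
  show "wl \<le> wu" using start(1) by (auto intro: order_trans)
  fix v assume "v \<in> {wl..wu}" "\<forall>i. link_flow \<alpha> v $ i < c $ i"
  then show thesis by (rule that)
qed

text \<open>The reason is \<open>\<alpha> < c $ i + c $ j\<close>, which strictly feasible weights witness.\<close>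
lemma overload_excludes_other:
  assumes "i \<noteq> j" "0 \<le> t" "c $ i \<le> f t $ i"
  shows "f t $ j < c $ j"
proof -
  obtain v where v: "v \<in> {wl..wu}" "\<forall>i. link_flow \<alpha> v $ i < c $ i"
    by (rule feasible_weights)
  have "0 < v $ k" for k
    using v wl_pos by (auto simp: less_eq_vec_def intro: less_le_trans)
  then have "\<alpha> = link_flow \<alpha> v $ i + link_flow \<alpha> v $ j"
    using link_flow_add[OF \<open>i \<noteq> j\<close>, of v] by (simp add: add_pos_pos)
  then have "\<alpha> < c $ i + c $ j" using v(2)[rule_format, of i] v(2)[rule_format, of j] by simp
  moreover have "f t $ i + f t $ j = \<alpha>"
    using link_flow_add[OF \<open>i \<noteq> j\<close>] weight_pos[OF \<open>0 \<le> t\<close>] by (simp add: add_pos_pos)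
  ultimately show ?thesis using assms by linarith
qed

lemma flow_cont:
  assumes "i \<noteq> j"
  shows "continuous_on {0..} (\<lambda>t. f t $ i)"
  unfolding link_flow_nth[OF assms]
proof (intro continuous_on_divide continuous_on_mult continuous_on_const continuous_on_add
    weight_cont ballI)
  fix t :: real assume "t \<in> {0..}"
  then have "0 < w t $ i" "0 < w t $ j" using weight_pos by auto
  then show "w t $ i + w t $ j \<noteq> 0" by simp
qed

text \<open>
  Above capacity the controller does not raise the weight of \<open>i\<close> and does not lower the weight of
  the other link, which is below its capacity; so the flow on \<open>i\<close> does not rise.
\<close>
lemma capacity_kept:
  assumes "i \<noteq> j" "0 \<le> s" "s \<le> t" "f s $ i \<le> c $ i"
  shows "f t $ i \<le> c $ i"
proof (rule right_derivative_barrier[where h = "\<lambda>t. f t $ i" and a = s])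
  show "continuous_on {s..t} (\<lambda>t. f t $ i)"
    using flow_cont[OF assms(1)] by (rule continuous_on_subset) (use assms in auto)
next
  fix z assume z: "s < z" "c $ i < f z $ i"
  then have "0 < z" using assms by simp
  have other: "f z $ j < c $ j"
    using overload_excludes_other[of i j z] assms z by simp
  have "u z $ i \<le> 0" "0 \<le> u z $ j"
    using z other lam_pos by (auto simp: control_def less_imp_le)
  moreover have w_pos: "0 < w z $ i" "0 < w z $ j" using weight_pos \<open>0 < z\<close> by auto
  ultimately have "u z $ i * w z $ j \<le> 0" "0 \<le> w z $ i * u z $ j"
    by (auto simp: mult_nonpos_nonneg)
  then have "\<alpha> * (u z $ i * w z $ j - w z $ i * u z $ j) / (w z $ i + w z $ j)^2 \<le> 0"
    using alpha_nonneg by (intro divide_nonpos_nonneg mult_nonneg_nonpos) auto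
  then show "\<exists>d\<le>0. ((\<lambda>t. f t $ i) has_real_derivative d) (at_right z)"
    using link_flow_has_derivative[OF \<open>i \<noteq> j\<close> w_pos weight_derivative weight_derivative] \<open>0 < z\<close>
    by (intro exI conjI) auto
qed fact+

text \<open>
  An overload at time \<open>0\<close> means that the magnitude has increased, since the flow was feasible before
  the disturbance. This is what sets the weight of the other link in motion; from then on
  \<open>overload_reaches_corner\<close> applies.
\<close>
lemma overload_ends:
  assumes "i \<noteq> j"
  shows "\<exists>t\<ge>0. f t $ i \<le> c $ i"
proof (rule ccontr)
  assume "\<not> ?thesis"
  then have over: "c $ i < f t $ i" if "0 \<le> t" for t
    using that by force
  have under: "f t $ j < c $ j" if "0 \<le> t" for t
    using overload_excludes_other[OF assms that] over[OF that] by simp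
  \<comment> \<open>The weights are the same just before and just after the disturbance, only the magnitude differs.\<close>
  have "\<alpha>0 < \<alpha>"
  proof -
    have w0: "w0 = w 0" using traj by (simp add: trajectory_def)
    then have "link_flow \<alpha>0 (w 0) $ i < f 0 $ i"
      using over[of 0] start(2) by (metis le_less_trans order_refl)
    then have "\<alpha>0 * (w 0 $ i / (w 0 $ i + w 0 $ j)) < \<alpha> * (w 0 $ i / (w 0 $ i + w 0 $ j))"
      by (simp add: link_flow_nth[OF assms])
    moreover have "0 < w 0 $ i / (w 0 $ i + w 0 $ j)"
      using weight_pos[of 0] by (simp add: add_pos_pos)
    ultimately show ?thesis by (simp only: mult_less_cancel_right_pos)
  qed
  have "0 < \<alpha>"
    using over[of 0] c_pos[rule_format, of i] alpha_nonneg
    by (cases "\<alpha> = 0") (auto simp: link_flow_def)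
  have ui: "u t $ i = (if wl $ i < w t $ i then - lam $ i else 0)" if "0 \<le> t" for t
    using over[OF that] by (auto simp: control_def)
  then have started: "u t $ i < lam $ i" if "0 \<le> t" for t
    using that lam_pos[rule_format, of i] by simp
  have "\<exists>t\<ge>0. w t $ i = wl $ i \<and> w t $ j = wu $ j"
  proof (rule overload_reaches_corner[where R = "flow_rising \<alpha>0 \<alpha> w j"])
    show "((\<lambda>t. w t $ i) has_real_derivative (if wl $ i < w t $ i then - lam $ i else 0)) (at_right t)"
      if "0 \<le> t" for t
      using weight_derivative[OF that started[OF that], of i] ui[OF that] by simp
    show "((\<lambda>t. w t $ j) has_real_derivative
        (if flow_rising \<alpha>0 \<alpha> w j t \<and> w t $ j < wu $ j then lam $ j else 0)) (at_right t)"
      if "0 \<le> t" for t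
    proof -
      have "u t $ j = (if flow_rising \<alpha>0 \<alpha> w j t \<and> w t $ j < wu $ j then lam $ j else 0)"
        using under[OF that] by (auto simp: control_def)
      then show ?thesis using weight_derivative[OF that started[OF that], of j] by simp
    qed
    show "flow_rising \<alpha>0 \<alpha> w j t \<longleftrightarrow>
        (\<exists>D>0. ((\<lambda>s. \<alpha> * w s $ j / (w s $ i + w s $ j)) has_real_derivative D) (at_left t))"
      if "0 < t" for t
      using that assms by (simp add: flow_rising_def link_flow_nth[of j i] add.commute)
    show "flow_rising \<alpha>0 \<alpha> w j 0" using \<open>\<alpha>0 < \<alpha>\<close> by (simp add: flow_rising_def)
  qed (simp_all add: \<open>0 < \<alpha>\<close> lam_pos wl_pos weight_cont weight_in_box weight_pos)
  then obtain t where t: "0 \<le> t" "w t $ i = wl $ i" "w t $ j = wu $ j" by blast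
  obtain v where v: "v \<in> {wl..wu}" "\<forall>i. link_flow \<alpha> v $ i < c $ i"
    by (rule feasible_weights)
  have v_box: "wl $ k \<le> v $ k" "v $ k \<le> wu $ k" for k
    using v(1) by (auto simp: less_eq_vec_def)
  have "0 < v $ j" using wl_pos v_box(1)[of j] by (auto intro: less_le_trans)
  then have "f t $ i \<le> link_flow \<alpha> v $ i"
    using weight_pos[OF t(1), of i] v_box t(2,3)
    by (intro link_flow_mono[OF assms alpha_nonneg]) auto
  then show False using over[OF t(1)] v(2)[rule_format, of i] by simp
qed

lemma eventually_feasible: "\<exists>T\<ge>0. \<forall>t\<ge>T. \<forall>k. f t $ k \<le> c $ k"
proof -
  obtain s t where s: "0 \<le> s" "f s $ 1 \<le> c $ 1" and t: "0 \<le> t" "f t $ 2 \<le> c $ 2"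
    using overload_ends[of 1 2] overload_ends[of 2 1] by auto
  then show ?thesis
    using capacity_kept[of 1 2 s] capacity_kept[of 2 1 t]
    by (intro exI[of _ "max s t"]) (auto simp: forall_2)
qed

text \<open>
  Without an overload no weight is ever lowered, so the weights converge by monotonicity. Their
  limits are positive, as they are at least the lower bounds, and the flow depends continuously on
  positive weights.
\<close>
lemma flow_converges: "\<exists>L \<in> {0..c}. (f \<longlongrightarrow> L) at_top"
proof -
  obtain T where "0 \<le> T" and T: "\<And>t k. T \<le> t \<Longrightarrow> f t $ k \<le> c $ k"
    using eventually_feasible by blast
  have mono: "w s $ k \<le> w t $ k" if "T \<le> s" "s \<le> t" for s t k
    using \<open>s \<le> t\<close>
  proof (rule right_derivative_nonneg_mono)
    show "continuous_on {s..t} (\<lambda>t. w t $ k)"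
      using weight_cont by (rule continuous_on_subset) (use that \<open>0 \<le> T\<close> in auto)
    fix z assume "s < z"
    then have z: "T \<le> z" "0 < z" using that \<open>0 \<le> T\<close> by auto
    then have "0 \<le> u z $ k" using T[of z k] lam_pos by (auto simp: control_def less_imp_le)
    then show "\<exists>d\<ge>0. ((\<lambda>t. w t $ k) has_real_derivative d) (at_right z)"
      using weight_derivative[of z] z by (intro exI[of _ "u z $ k"]) auto
  qed
  have "\<exists>l. ((\<lambda>t. w t $ k) \<longlongrightarrow> l) at_top" for k
  proof (rule mono_bounded_convergent_at_top)
    show "w s $ k \<le> w t $ k" if "T \<le> s" "s \<le> t" for s t
      using that by (rule mono)
    show "w t $ k \<le> wu $ k" if "T \<le> t" for t
      using weight_in_box(2) that \<open>0 \<le> T\<close> by simp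
  qed
  then obtain l where l: "\<And>k. ((\<lambda>t. w t $ k) \<longlongrightarrow> l k) at_top" by metis
  have l_pos: "0 < l k" for k
  proof -
    have "wl $ k \<le> l k"
      by (rule tendsto_lowerbound[OF l])
        (use weight_in_box(1) in \<open>auto simp: eventually_at_top_linorder intro!: exI[of _ 0]\<close>)
    then show ?thesis using wl_pos by (auto intro: less_le_trans)
  qed
  define L :: "real ^ 2" where "L = (\<chi> i. \<alpha> * l i / (l 1 + l 2))"
  have lim: "((\<lambda>t. f t $ i) \<longlongrightarrow> L $ i) at_top" for i
    unfolding link_flow_def L_def using l_pos[of 1] l_pos[of 2]
    by (auto intro!: tendsto_intros l)
  have "L $ i \<le> c $ i" for i
    by (rule tendsto_upperbound[OF lim])
      (use T in \<open>auto simp: eventually_at_top_linorder\<close>)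
  moreover have "0 \<le> L $ i" for i
    using alpha_nonneg l_pos by (simp add: L_def add_pos_pos less_imp_le)
  ultimately have "L \<in> {0..c}" by (auto simp: less_eq_vec_def)
  then show ?thesis using vec_tendstoI[OF lim] by blast
qed

end

theorem proposition10:
  fixes wl wu c lam w0 :: "real ^ 2" and \<alpha>0 \<alpha> :: real and w :: "real \<Rightarrow> real ^ 2"
  assumes "\<forall>i. 0 < wl $ i" and "\<forall>i. 0 < wu $ i"
    and "\<forall>i. 0 < c $ i"
    and "\<forall>i. 0 < lam $ i"
    and "0 \<le> \<alpha>"
    and "w0 \<in> {wl..wu}"
    and "0 \<le> \<alpha>0" and "\<forall>i. link_flow \<alpha>0 w0 $ i \<le> c $ i"
    and "trajectory \<alpha>0 \<alpha> wl wu c lam w0 w"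
    and "\<alpha> < alpha_star wl wu c"
  shows "\<exists>L \<in> {0..c}. ((\<lambda>t. link_flow \<alpha> (w t)) \<longlongrightarrow> L) at_top"
proof -
  interpret controlled_network \<alpha>0 \<alpha> wl wu c lam w0 w
    by unfold_locales fact+
  show ?thesis by (rule flow_converges)
qed

end
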